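(* Let $\Sigma$ be a finite set with at least two elements. Then the Büchi topology on $T_\Sigma^\omega$ is not metrizable (and hence not Polish).
   Context: $T_\Sigma^\omega$ is the set of maps $\{l,r\}^*\to\Sigma$ (infinite binary $\Sigma$-labelled trees). A Büchi tree automaton is $(\Sigma,Q,q_0,Q_f,\Delta)$ with $\Delta\subseteq Q\times\Sigma\times Q\times Q$; a run on $t$ is $\rho:\{l,r\}^*\to Q$ with $\rho(\text{root})=q_0$ and $(\rho(u),t(u),\rho(ul),\rho(ur))\in\Delta$; it is accepting if along every infinite branch some state of $Q_f$ occurs infinitely often; the automaton accepts the trees having an accepting run. The Büchi topology on $T_\Sigma^\omega$ is the topology generated by the tree languages accepted by Büchi tree automata. *)

theory Defs
  imports "HOL-Analysis.Analysis"
begin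

datatype dir = L | R

type_synonym 'a inftree = "dir list \<Rightarrow> 'a"

text \<open>Buechi tree automaton (Sigma, Q, q0, Qf, Delta); Sigma is the alphabet type,
  states are natural numbers (w.l.o.g. by renaming); Q is finite.\<close>
record 'a buchi_tree_aut =
  states :: "nat set"
  init :: nat
  final :: "nat set"
  trans :: "(nat \<times> 'a \<times> nat \<times> nat) set"

definition wf_bta :: "'a buchi_tree_aut \<Rightarrow> bool" where
  "wf_bta A \<longleftrightarrow> finite (states A) \<and> init A \<in> states A \<and> final A \<subseteq> states A
     \<and> trans A \<subseteq> states A \<times> UNIV \<times> states A \<times> states A"

definition is_run :: "'a buchi_tree_aut \<Rightarrow> 'a inftree \<Rightarrow> (dir list \<Rightarrow> nat) \<Rightarrow> bool" where
  "is_run A t \<rho> \<longleftrightarrow> \<rho> [] = init A \<and>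
     (\<forall>u. (\<rho> u, t u, \<rho> (u @ [L]), \<rho> (u @ [R])) \<in> trans A)"

definition accepting_run :: "'a buchi_tree_aut \<Rightarrow> (dir list \<Rightarrow> nat) \<Rightarrow> bool" where
  "accepting_run A \<rho> \<longleftrightarrow>
     (\<forall>\<pi> :: nat \<Rightarrow> dir. \<exists>\<^sub>\<infinity>n. \<rho> (map \<pi> [0..<n]) \<in> final A)"

definition bta_lang :: "'a buchi_tree_aut \<Rightarrow> 'a inftree set" where
  "bta_lang A = {t. \<exists>\<rho>. is_run A t \<rho> \<and> accepting_run A \<rho>}"

definition buchi_recognizable :: "'a inftree set set" where
  "buchi_recognizable = {bta_lang A | A. wf_bta A}"

definition buchi_topology :: "'a inftree topology" where
  "buchi_topology = topology_generated_by buchi_recognizable"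

end

theory Submission
  imports Defs
begin

text \<open>
  Fix a letter \<open>a\<close>. The trees with a branch carrying infinitely many \<open>a\<close> form a Buechi language, so
  its complement \<open>W\<close> is closed, and in a metrizable space it would be a countable intersection of
  open sets. There are only countably many automata, and Buechi acceptance is an analytic condition:
  by Koenig's lemma a run is accepting iff for every \<open>m\<close> there is a bound \<open>h m\<close> such that all
  branches meet a final state between levels \<open>m\<close> and \<open>h m\<close>. Hence every open set, and then \<open>W\<close>,
  would be analytic. But if \<open>W\<close> is the projection of a closed relation \<open>C\<close>, one builds by recursion
  on levels a tree \<open>t\<close> whose letters \<open>a\<close> mark exactly the finite approximations to
  witnesses \<open>f\<close> of \<open>C t f\<close>, so that \<open>t \<in> W \<longleftrightarrow> t \<notin> W\<close>.
\<close>

instance dir :: countable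
  by countable_datatype

section \<open>Analytic sets of trees\<close>

text \<open>Closedness in the product of discrete spaces, spelled out by basic neighbourhoods:
  failure of \<open>C\<close> is already forced by finitely many labels and finitely many values.
  The index type is free so that witnesses may consist of several components.\<close>

definition closed_rel :: "('a inftree \<Rightarrow> ('i \<Rightarrow> nat) \<Rightarrow> bool) \<Rightarrow> bool" where
  "closed_rel C \<longleftrightarrow> (\<forall>t f. \<not> C t f \<longrightarrow> (\<exists>U I. finite U \<and> finite I \<and>
     (\<forall>t' f'. (\<forall>u\<in>U. t' u = t u) \<longrightarrow> (\<forall>i\<in>I. f' i = f i) \<longrightarrow> \<not> C t' f')))"

text \<open>The classical notion: projections of closed sets along Baire space.\<close>

definition analytic :: "'a inftree set \<Rightarrow> bool" where
  "analytic A \<longleftrightarrow> (\<exists>C :: 'a inftree \<Rightarrow> (nat \<Rightarrow> nat) \<Rightarrow> bool. closed_rel C \<and> A = {t. \<exists>f. C t f})"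

lemma closed_relI:
  assumes "\<And>t f. \<not> C t f \<Longrightarrow> \<exists>U I. finite U \<and> finite I \<and>
     (\<forall>t' f'. (\<forall>u\<in>U. t' u = t u) \<longrightarrow> (\<forall>i\<in>I. f' i = f i) \<longrightarrow> \<not> C t' f')"
  shows "closed_rel C"
  using assms unfolding closed_rel_def by blast

lemma closed_relE:
  assumes "closed_rel C" "\<not> C t f"
  obtains U I where "finite U" "finite I"
    "\<And>t' f'. (\<And>u. u \<in> U \<Longrightarrow> t' u = t u) \<Longrightarrow> (\<And>i. i \<in> I \<Longrightarrow> f' i = f i) \<Longrightarrow> \<not> C t' f'"
  using assms unfolding closed_rel_def by metis

lemma closed_rel_All:
  assumes "\<And>x. closed_rel (C x)"
  shows "closed_rel (\<lambda>t f. \<forall>x. C x t f)"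
proof (rule closed_relI)
  fix t f
  assume "\<not> (\<forall>x. C x t f)"
  then obtain x where "\<not> C x t f"
    by blast
  with assms[of x] obtain U I where "finite U" "finite I"
    "\<And>t' f'. (\<And>u. u \<in> U \<Longrightarrow> t' u = t u) \<Longrightarrow> (\<And>i. i \<in> I \<Longrightarrow> f' i = f i) \<Longrightarrow> \<not> C x t' f'"
    by (rule closed_relE) auto
  then show "\<exists>U I. finite U \<and> finite I \<and> (\<forall>t' f'. (\<forall>u\<in>U. t' u = t u) \<longrightarrow>
      (\<forall>i\<in>I. f' i = f i) \<longrightarrow> \<not> (\<forall>x. C x t' f'))"
    by (intro exI[of _ U] exI[of _ I]) blast
qed

lemma closed_rel_conj:
  assumes "closed_rel C" "closed_rel D"
  shows "closed_rel (\<lambda>t f. C t f \<and> D t f)"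
proof -
  have "closed_rel (\<lambda>t f. \<forall>b. (if b then C else D) t f)"
    using assms by (intro closed_rel_All) simp
  then show ?thesis
    by (simp add: all_bool_eq)
qed

lemma closed_rel_reindex:
  assumes "closed_rel C"
  shows "closed_rel (\<lambda>t f. C t (\<lambda>i. f (g i)))"
proof (rule closed_relI)
  fix t :: "'a inftree" and f :: "'c \<Rightarrow> nat"
  assume "\<not> C t (\<lambda>i. f (g i))"
  then obtain U I where UI: "finite U" "finite I"
    "\<And>t' f'. (\<And>u. u \<in> U \<Longrightarrow> t' u = t u) \<Longrightarrow> (\<And>i. i \<in> I \<Longrightarrow> f' i = f (g i)) \<Longrightarrow> \<not> C t' f'"
    using assms by (elim closed_relE) auto
  show "\<exists>U I. finite U \<and> finite I \<and> (\<forall>t' f'. (\<forall>u\<in>U. t' u = t u) \<longrightarrow>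
      (\<forall>i\<in>I. f' i = f i) \<longrightarrow> \<not> C t' (\<lambda>i. f' (g i)))"
    by (rule exI[of _ U], rule exI[of _ "g ` I"]) (use UI in auto)
qed

text \<open>Any countable index type will do for the witnesses: \<open>to_nat\<close> embeds it into
  the naturals, and \<open>from_nat\<close> turns a witness over the original type back into a
  sequence.\<close>

lemma analyticI:
  fixes C :: "'a inftree \<Rightarrow> ('i::countable \<Rightarrow> nat) \<Rightarrow> bool"
  assumes "closed_rel C" "\<And>t. t \<in> A \<longleftrightarrow> (\<exists>f. C t f)"
  shows "analytic A"
  unfolding analytic_def
proof (intro exI conjI)
  show "closed_rel (\<lambda>t (f :: nat \<Rightarrow> nat). C t (\<lambda>i. f (to_nat i)))"
    using assms(1) by (rule closed_rel_reindex)
  have "\<exists>f :: nat \<Rightarrow> nat. C t (\<lambda>i. f (to_nat i))" if "C t g" for t g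
    by (rule exI[of _ "\<lambda>n. g (from_nat n)"]) (simp add: that)
  then show "A = {t. \<exists>f :: nat \<Rightarrow> nat. C t (\<lambda>i. f (to_nat i))}"
    using assms(2) by blast
qed

lemma analytic_UNIV: "analytic UNIV"
  by (rule analyticI[of "\<lambda>_ (_ :: nat \<Rightarrow> nat). True"]) (auto simp: closed_rel_def)

lemma analytic_empty: "analytic {}"
  by (rule analyticI[of "\<lambda>_ (_ :: nat \<Rightarrow> nat). False"]) (auto simp: closed_rel_def)

text \<open>One function on pairs stores a whole sequence of witnesses, one per set; the conjunction
  over \<open>n\<close> remains closed.\<close>

lemma analytic_INT_nat:
  assumes "\<And>n :: nat. analytic (A n)"
  shows "analytic (\<Inter>n. A n)"
proof -
  obtain C :: "nat \<Rightarrow> 'a inftree \<Rightarrow> (nat \<Rightarrow> nat) \<Rightarrow> bool"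
    where C: "\<And>n. closed_rel (C n)" "\<And>n. A n = {t. \<exists>f. C n t f}"
    using assms unfolding analytic_def by metis
  show ?thesis
  proof (rule analyticI)
    show "closed_rel (\<lambda>t (f :: nat \<times> nat \<Rightarrow> nat). \<forall>n. C n t (\<lambda>i. f (n, i)))"
      by (rule closed_rel_All, rule closed_rel_reindex, rule C)
    fix t
    show "t \<in> (\<Inter>n. A n) \<longleftrightarrow> (\<exists>f :: nat \<times> nat \<Rightarrow> nat. \<forall>n. C n t (\<lambda>i. f (n, i)))"
    proof
      assume "t \<in> (\<Inter>n. A n)"
      then obtain g where "\<And>n. C n t (g n)"
        using C(2) by simp metis
      then show "\<exists>f :: nat \<times> nat \<Rightarrow> nat. \<forall>n. C n t (\<lambda>i. f (n, i))"
        by (intro exI[of _ "\<lambda>(n, i). g n i"]) simp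
    qed (use C(2) in auto)
  qed
qed

text \<open>Infinite unions of closed relations need not be closed, so the witness also names, in
  coordinate \<open>None\<close>, the set it speaks about.\<close>

lemma analytic_UN_nat:
  assumes "\<And>n :: nat. analytic (A n)"
  shows "analytic (\<Union>n. A n)"
proof -
  obtain C :: "nat \<Rightarrow> 'a inftree \<Rightarrow> (nat \<Rightarrow> nat) \<Rightarrow> bool"
    where C: "\<And>n. closed_rel (C n)" "\<And>n. A n = {t. \<exists>f. C n t f}"
    using assms unfolding analytic_def by metis
  show ?thesis
  proof (rule analyticI)
    show "closed_rel (\<lambda>t (f :: nat option \<Rightarrow> nat). C (f None) t (\<lambda>i. f (Some i)))"
    proof (rule closed_relI)
      fix t and f :: "nat option \<Rightarrow> nat"
      assume "\<not> C (f None) t (\<lambda>i. f (Some i))"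
      then obtain U I where UI: "finite U" "finite I"
        "\<And>t' f'. (\<And>u. u \<in> U \<Longrightarrow> t' u = t u) \<Longrightarrow> (\<And>i. i \<in> I \<Longrightarrow> f' i = f (Some i)) \<Longrightarrow>
          \<not> C (f None) t' f'"
        using C(1)[of "f None"] by (elim closed_relE) auto
      show "\<exists>U I. finite U \<and> finite I \<and> (\<forall>t' f'. (\<forall>u\<in>U. t' u = t u) \<longrightarrow>
          (\<forall>i\<in>I. f' i = f i) \<longrightarrow> \<not> C (f' None) t' (\<lambda>i. f' (Some i)))"
        \<comment> \<open>Including \<open>None\<close> keeps the chosen set fixed on the whole
          neighbourhood.\<close>
        by (rule exI[of _ U], rule exI[of _ "insert None (Some ` I)"]) (use UI in auto)
    qed
    fix t
    show "t \<in> (\<Union>n. A n) \<longleftrightarrow> (\<exists>f :: nat option \<Rightarrow> nat. C (f None) t (\<lambda>i. f (Some i)))"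
    proof
      assume "t \<in> (\<Union>n. A n)"
      then obtain n g where "C n t g"
        using C(2) by auto
      then show "\<exists>f :: nat option \<Rightarrow> nat. C (f None) t (\<lambda>i. f (Some i))"
        by (intro exI[of _ "case_option n g"]) simp
    qed (use C(2) in auto)
  qed
qed

lemma analytic_Inter:
  assumes "countable F" "\<And>A. A \<in> F \<Longrightarrow> analytic A"
  shows "analytic (\<Inter>F)"
proof (cases "F = {}")
  case False
  then have "\<Inter>F = (\<Inter>n. from_nat_into F n)"
    using assms(1) by (metis range_from_nat_into)
  then show ?thesis
    using analytic_INT_nat assms(2) False by (metis from_nat_into)
qed (simp add: analytic_UNIV)

lemma analytic_Union:
  assumes "countable F" "\<And>A. A \<in> F \<Longrightarrow> analytic A"
  shows "analytic (\<Union>F)"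
proof (cases "F = {}")
  case False
  then have "\<Union>F = (\<Union>n. from_nat_into F n)"
    using assms(1) by (metis range_from_nat_into)
  then show ?thesis
    using analytic_UN_nat assms(2) False by (metis from_nat_into)
qed (simp add: analytic_empty)

section \<open>Open sets of the Buechi topology are analytic\<close>

text \<open>\<open>X u\<close> says that paths through \<open>u\<close> stay good up to every depth.
  This passes from a node to one of its two children, and following such children gives the
  branch.\<close>

lemma Koenig_branch:
  assumes "\<And>k. \<exists>p :: nat \<Rightarrow> dir. \<forall>n\<le>k. P (map p [0..<n])"
  shows "\<exists>p :: nat \<Rightarrow> dir. \<forall>n. P (map p [0..<n])"
proof -
  define X where "X u \<longleftrightarrow> (\<forall>k. \<exists>p :: nat \<Rightarrow> dir. map p [0..<length u] = u \<and>
    (\<forall>n\<le>k. P (map p [0..<n])))" for u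
  have X0: "X []"
    using assms by (simp add: X_def)
  have step: "\<exists>d. X (u @ [d])" if Xu: "X u" for u
  proof (rule ccontr)
    assume "\<not> (\<exists>d. X (u @ [d]))"
    \<comment> \<open>If both children fail, they do so at depths \<open>k L\<close> and
      \<open>k R\<close>; a path through \<open>u\<close> that is good up to the larger depth must
      still enter one of them.\<close>
    then obtain k where k: "\<And>d p. map p [0..<length (u @ [d])] = u @ [d] \<Longrightarrow>
        \<not> (\<forall>n\<le>k d. P (map p [0..<n]))"
      unfolding X_def by metis
    obtain p where p: "map p [0..<length u] = u" "\<forall>n\<le>max (k L) (k R). P (map p [0..<n])"
      using Xu unfolding X_def by blast
    have "\<forall>n\<le>k (p (length u)). P (map p [0..<n])"
      using p(2) by (cases "p (length u)") auto
    then show False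
      using k[of p "p (length u)"] p(1) by simp
  qed
  then obtain d where d: "\<And>u. X u \<Longrightarrow> X (u @ [d u])"
    by metis
  define w where "w = rec_nat [] (\<lambda>_ u. u @ [d u])"
  have w: "w 0 = []" "\<And>n. w (Suc n) = w n @ [d (w n)]"
    by (simp_all add: w_def)
  have Xw: "X (w n)" for n
    by (induction n) (auto simp: w X0 d)
  have mw: "map (\<lambda>n. d (w n)) [0..<n] = w n" for n
    by (induction n) (auto simp: w)
  have len: "length (w n) = n" for n
    by (induction n) (auto simp: w)
  have "P (w n)" for n
    using Xw[of n] unfolding X_def len by (metis order_refl)
  then show ?thesis
    using mw by metis
qed

text \<open>If no bound works for \<open>m\<close>, then for every \<open>k\<close> some path avoids
  final states on levels \<open>m\<close> to \<open>k\<close>, and Koenig's lemma gives a branch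
  avoiding them from \<open>m\<close> on. With \<open>h\<close> as part of the witness, what remains
  is a closed condition.\<close>

lemma accepting_run_iff_bounded:
  "accepting_run A \<rho> \<longleftrightarrow>
    (\<exists>h. \<forall>m p. \<exists>n\<in>{m..h m}. \<rho> (map p [0..<n]) \<in> final A)"
proof
  assume acc: "accepting_run A \<rho>"
  have "\<exists>k. \<forall>p. \<exists>n\<in>{m..k}. \<rho> (map p [0..<n]) \<in> final A" for m
  proof (rule ccontr)
    assume "\<nexists>k. \<forall>p. \<exists>n\<in>{m..k}. \<rho> (map p [0..<n]) \<in> final A"
    then have "\<exists>p :: nat \<Rightarrow> dir. \<forall>n\<le>k. m \<le> length (map p [0..<n]) \<longrightarrow>
        \<rho> (map p [0..<n]) \<notin> final A" for k
      by fastforce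
    from Koenig_branch[of "\<lambda>u. m \<le> length u \<longrightarrow> \<rho> u \<notin> final A", OF this]
    obtain p where "\<And>n. m \<le> n \<Longrightarrow> \<rho> (map p [0..<n]) \<notin> final A"
      by auto
    then show False
      using acc unfolding accepting_run_def INFM_nat_le by blast
  qed
  then show "\<exists>h. \<forall>m p. \<exists>n\<in>{m..h m}. \<rho> (map p [0..<n]) \<in> final A"
    by (intro choice) blast
next
  assume "\<exists>h. \<forall>m p. \<exists>n\<in>{m..h m}. \<rho> (map p [0..<n]) \<in> final A"
  then show "accepting_run A \<rho>"
    unfolding accepting_run_def INFM_nat_le by (meson atLeastAtMost_iff)
qed

text \<open>A witness is a run (\<open>Inl\<close> coordinates) together with a bound
  \<open>h\<close> (\<open>Inr\<close> coordinates). The quantifier over uncountably many branches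
  is harmless, as closed relations are stable under arbitrary conjunctions.\<close>

lemma analytic_bta_lang: "analytic (bta_lang A)"
proof (rule analyticI)
  let ?C = "\<lambda>t (f :: dir list + nat \<Rightarrow> nat).
    (f (Inl []) = init A \<and>
      (\<forall>u. (f (Inl u), t u, f (Inl (u @ [L])), f (Inl (u @ [R]))) \<in> trans A)) \<and>
    (\<forall>m p. \<exists>n\<in>{m..f (Inr m)}. f (Inl (map p [0..<n])) \<in> final A)"
  show "closed_rel ?C"
  proof (intro closed_rel_conj closed_rel_All)
    show "closed_rel (\<lambda>(t :: 'a inftree) f. f (Inl [] :: dir list + nat) = init A)"
      by (rule closed_relI, rule exI[of _ "{}"], rule exI[of _ "{Inl []}"]) auto
    show "closed_rel (\<lambda>t (f :: dir list + nat \<Rightarrow> nat).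
        (f (Inl u), t u, f (Inl (u @ [L])), f (Inl (u @ [R]))) \<in> trans A)" for u
      by (rule closed_relI, rule exI[of _ "{u}"],
          rule exI[of _ "{Inl u, Inl (u @ [L]), Inl (u @ [R])}"]) auto
    show "closed_rel (\<lambda>(t :: 'a inftree) f.
        \<exists>n\<in>{m..f (Inr m)}. f (Inl (map p [0..<n])) \<in> final A)" for m and p :: "nat \<Rightarrow> dir"
    proof (rule closed_relI)
      fix t :: "'a inftree" and f :: "dir list + nat \<Rightarrow> nat"
      assume *: "\<not> (\<exists>n\<in>{m..f (Inr m)}. f (Inl (map p [0..<n])) \<in> final A)"
      show "\<exists>U I. finite U \<and> finite I \<and> (\<forall>t' f'. (\<forall>u\<in>U. t' u = t u) \<longrightarrow>
          (\<forall>i\<in>I. f' i = f i) \<longrightarrow>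
          \<not> (\<exists>n\<in>{m..f' (Inr m)}. f' (Inl (map p [0..<n])) \<in> final A))"
        \<comment> \<open>Fixing \<open>f (Inr m)\<close> freezes the range of \<open>n\<close>, so
          only finitely many nodes of \<open>p\<close> matter.\<close>
        by (rule exI[of _ "{}"],
            rule exI[of _ "insert (Inr m) ((\<lambda>n. Inl (map p [0..<n])) ` {m..f (Inr m)})"])
          (use * in auto)
    qed
  qed
  fix t
  show "t \<in> bta_lang A \<longleftrightarrow> (\<exists>f. ?C t f)"
  proof
    assume "t \<in> bta_lang A"
    then obtain \<rho> h where "is_run A t \<rho>" "\<forall>m p. \<exists>n\<in>{m..h m}. \<rho> (map p [0..<n]) \<in> final A"
      unfolding bta_lang_def accepting_run_iff_bounded by blast
    then show "\<exists>f. ?C t f"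
      by (intro exI[of _ "case_sum \<rho> h"]) (simp add: is_run_def)
  next
    assume "\<exists>f. ?C t f"
    then obtain f where f: "?C t f" ..
    then have "is_run A t (\<lambda>u. f (Inl u))" "accepting_run A (\<lambda>u. f (Inl u))"
      unfolding is_run_def accepting_run_iff_bounded
      by (blast, intro exI[of _ "\<lambda>m. f (Inr m)"]) blast
    then show "t \<in> bta_lang A"
      unfolding bta_lang_def by blast
  qed
qed

section \<open>A countable base of analytic sets\<close>

text \<open>A well-formed automaton consists of finite data over countable sets; its transition
  relation is finite because the alphabet is.\<close>

lemma countable_buchi_recognizable:
  "countable (buchi_recognizable :: 'a::finite inftree set set)"
proof -
  let ?T = "{S :: (nat \<times> 'a \<times> nat \<times> nat) set. finite S \<and> S \<subseteq> UNIV}"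
  let ?N = "{S :: nat set. finite S \<and> S \<subseteq> UNIV}"
  have "countable (UNIV :: 'a set)"
    by (simp add: countable_finite)
  then have "countable (UNIV \<times> UNIV \<times> UNIV \<times> UNIV :: (nat \<times> 'a \<times> nat \<times> nat) set)"
    by (intro countable_SIGMA) auto
  then have "countable (UNIV :: (nat \<times> 'a \<times> nat \<times> nat) set)"
    by simp
  then have cnt: "countable (?N \<times> (UNIV :: nat set) \<times> ?N \<times> ?T)"
    by (intro countable_SIGMA countable_Collect_finite_subset) auto
  have "buchi_recognizable \<subseteq>
    (\<lambda>(Q, q, F, D). bta_lang \<lparr>states = Q, init = q, final = F, trans = D\<rparr>) `
      (?N \<times> (UNIV :: nat set) \<times> ?N \<times> ?T)"
  proof
    fix X :: "'a inftree set"
    assume "X \<in> buchi_recognizable"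
    then obtain A where A: "X = bta_lang A" "wf_bta A"
      unfolding buchi_recognizable_def by blast
    have "finite (states A)" "finite (final A)"
      using A(2) unfolding wf_bta_def by (auto intro: finite_subset)
    moreover have "finite (trans A)"
    proof (rule finite_subset)
      show "trans A \<subseteq> states A \<times> UNIV \<times> states A \<times> states A"
        using A(2) unfolding wf_bta_def by blast
    qed (use \<open>finite (states A)\<close> in simp)
    ultimately show "X \<in> (\<lambda>(Q, q, F, D). bta_lang \<lparr>states = Q, init = q, final = F, trans = D\<rparr>) `
      (?N \<times> (UNIV :: nat set) \<times> ?N \<times> ?T)"
      by (intro image_eqI[of _ _ "(states A, init A, final A, trans A)"])
        (cases A, simp_all add: A(1))
  qed
  then show ?thesis
    using cnt by (meson countable_image countable_subset)
qed

lemma generate_topology_on_finite_Inter: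
  assumes "generate_topology_on S U" "x \<in> U"
  shows "\<exists>F. finite F \<and> F \<subseteq> S \<and> x \<in> \<Inter>F \<and> \<Inter>F \<subseteq> U"
  using assms
proof (induction rule: generate_topology_on.induct)
  case (Int a b)
  then obtain F G where "finite F" "F \<subseteq> S" "x \<in> \<Inter>F" "\<Inter>F \<subseteq> a"
      "finite G" "G \<subseteq> S" "x \<in> \<Inter>G" "\<Inter>G \<subseteq> b"
    by auto
  then show ?case
    by (intro exI[of _ "F \<union> G"]) auto
next
  case (UN K)
  then show ?case
    by (meson Union_iff Union_upper order_trans)
next
  case (Basis s)
  then show ?case
    by (intro exI[of _ "{s}"]) auto
qed auto

text \<open>Finite intersections of generators form a base, and there are only countably many of
  them. So every open set is a countable union of analytic sets.\<close>

lemma analytic_openin_buchi: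
  assumes "openin (buchi_topology :: 'a::finite inftree topology) U"
  shows "analytic U"
proof -
  let ?B = "{F. finite F \<and> F \<subseteq> (buchi_recognizable :: 'a inftree set set)}"
  let ?G = "{F \<in> ?B. \<Inter>F \<subseteq> U}"
  have gen: "generate_topology_on buchi_recognizable U"
    using assms unfolding buchi_topology_def openin_topology_generated_by_iff .
  have "countable ?G"
    by (intro countable_subset[OF _ countable_Collect_finite_subset[OF countable_buchi_recognizable]])
      auto
  moreover have "analytic (\<Inter>F)" if "F \<in> ?G" for F
    using that by (intro analytic_Inter)
      (auto simp: countable_finite buchi_recognizable_def intro: analytic_bta_lang)
  ultimately have "analytic (\<Union>(Inter ` ?G))"
    by (intro analytic_Union) auto
  moreover have "U = \<Union>(Inter ` ?G)"
  proof (intro subset_antisym subsetI)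
    fix x
    assume "x \<in> U"
    from generate_topology_on_finite_Inter[OF gen this]
    obtain F where "finite F" "F \<subseteq> buchi_recognizable" "x \<in> \<Inter>F" "\<Inter>F \<subseteq> U"
      by (elim exE conjE)
    then show "x \<in> \<Union>(Inter ` ?G)"
      by (intro UnionI[of "\<Inter>F"] imageI) simp_all
  qed blast
  ultimately show ?thesis
    by simp
qed

section \<open>Trees with a branch carrying a letter infinitely often\<close>

definition inf_branch :: "'a \<Rightarrow> 'a inftree set" where
  "inf_branch a = {t. \<exists>p :: nat \<Rightarrow> dir. \<exists>\<^sub>\<infinity>n. t (map p [0..<n]) = a}"

text \<open>State \<open>0\<close> is used off the guessed branch; on it, state \<open>2\<close> records that the parent is
  labelled \<open>a\<close> and state \<open>1\<close> that it is not.\<close>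
definition inf_branch_aut :: "'a \<Rightarrow> 'a buchi_tree_aut" where
  "inf_branch_aut a = \<lparr>states = {0, 1, 2}, init = 1, final = {0, 2},
    trans = {(0, x, 0, 0) | x. True} \<union>
      {(q, x, q', 0) | q x q'. q \<in> {1, 2} \<and> q' = (if x = a then 2 else 1)} \<union>
      {(q, x, 0, q') | q x q'. q \<in> {1, 2} \<and> q' = (if x = a then 2 else 1)}\<rparr>"

lemma bta_lang_inf_branch_aut: "bta_lang (inf_branch_aut a) = inf_branch a"
proof (intro subset_antisym subsetI)
  fix t
  assume "t \<in> bta_lang (inf_branch_aut a)"
  then obtain \<rho> where run: "is_run (inf_branch_aut a) t \<rho>"
      and acc: "accepting_run (inf_branch_aut a) \<rho>"
    unfolding bta_lang_def by blast
  have root: "\<rho> [] = 1" and tr: "\<And>u. (\<rho> u, t u, \<rho> (u @ [L]), \<rho> (u @ [R])) \<in> trans (inf_branch_aut a)"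
    using run unfolding is_run_def by (auto simp: inf_branch_aut_def)
  \<comment> \<open>Every transition from a nonzero state hands a nonzero state to one child.
    Choosing that child at each step recovers the guessed branch \<open>w\<close>.\<close>
  have "\<exists>d. \<rho> u \<noteq> 0 \<longrightarrow> \<rho> (u @ [d]) = (if t u = a then 2 else 1)" for u
    using tr[of u] by (auto simp: inf_branch_aut_def)
  then obtain d where d: "\<And>u. \<rho> u \<noteq> 0 \<Longrightarrow> \<rho> (u @ [d u]) = (if t u = a then 2 else 1)"
    by metis
  define w where "w = rec_nat [] (\<lambda>_ u. u @ [d u])"
  have w: "w 0 = []" "\<And>n. w (Suc n) = w n @ [d (w n)]"
    by (simp_all add: w_def)
  have nz: "\<rho> (w n) \<noteq> 0" for n
    by (induction n) (auto simp: w root d)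
  have mw: "map (\<lambda>n. d (w n)) [0..<n] = w n" for n
    by (induction n) (auto simp: w)
  have "\<exists>\<^sub>\<infinity>n. \<rho> (w n) \<in> {0, 2}"
    using acc[unfolded accepting_run_def, rule_format, of "\<lambda>n. d (w n)"]
    by (simp add: mw inf_branch_aut_def)
  have "\<exists>\<^sub>\<infinity>n. t (w n) = a"
    unfolding INFM_nat_le
  proof
    fix m
    \<comment> \<open>A state reports the label of the parent, so a visit at level
      \<open>Suc m\<close> or later is needed to find an \<open>a\<close> at level \<open>m\<close>
      or later.\<close>
    obtain n where n: "n \<ge> Suc m" "\<rho> (w n) \<in> {0, 2}"
      using \<open>\<exists>\<^sub>\<infinity>n. \<rho> (w n) \<in> {0, 2}\<close> unfolding INFM_nat_le by blast
    then obtain k where k: "n = Suc k" "k \<ge> m"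
      by (cases n) auto
    have "t (w k) = a"
      using n(2) nz[of n] d[OF nz[of k]] by (auto simp: k(1) w split: if_splits)
    then show "\<exists>n\<ge>m. t (w n) = a"
      using k(2) by blast
  qed
  then show "t \<in> inf_branch a"
    unfolding inf_branch_def by (auto simp: mw intro!: exI[of _ "\<lambda>n. d (w n)"])
next
  fix t
  assume "t \<in> inf_branch a"
  then obtain p :: "nat \<Rightarrow> dir" where p: "\<exists>\<^sub>\<infinity>n. t (map p [0..<n]) = a"
    unfolding inf_branch_def by blast
  define on where "on u \<longleftrightarrow> map p [0..<length u] = u" for u
  define \<rho> :: "dir list \<Rightarrow> nat" where
    "\<rho> u = (if on u then if u \<noteq> [] \<and> t (butlast u) = a then 2 else 1 else 0)" for u
  have on_snoc: "on (u @ [d]) \<longleftrightarrow> on u \<and> d = p (length u)" for u d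
    by (auto simp: on_def)
  have "is_run (inf_branch_aut a) t \<rho>"
    unfolding is_run_def
  proof (intro conjI allI)
    show "\<rho> [] = init (inf_branch_aut a)"
      by (simp add: \<rho>_def on_def inf_branch_aut_def)
    show "(\<rho> u, t u, \<rho> (u @ [L]), \<rho> (u @ [R])) \<in> trans (inf_branch_aut a)" for u
      by (cases "p (length u)") (auto simp: \<rho>_def on_snoc inf_branch_aut_def)
  qed
  moreover have "accepting_run (inf_branch_aut a) \<rho>"
    unfolding accepting_run_def INFM_nat_le
  proof (intro allI)
    fix p' :: "nat \<Rightarrow> dir" and m
    show "\<exists>n\<ge>m. \<rho> (map p' [0..<n]) \<in> final (inf_branch_aut a)"
    \<comment> \<open>Either the branch is off \<open>p\<close> at some level from \<open>m\<close>
      on, where the state is \<open>0\<close>, or it follows \<open>p\<close> throughout and meets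
      state \<open>2\<close> just below a label \<open>a\<close>.\<close>
    proof (cases "\<exists>n\<ge>m. \<not> on (map p' [0..<n])")
      case True
      then obtain n where "n \<ge> m" "\<not> on (map p' [0..<n])"
        by blast
      then show ?thesis
        by (intro exI[of _ n]) (simp add: \<rho>_def inf_branch_aut_def)
    next
      case False
      obtain n where n: "n \<ge> m" "t (map p [0..<n]) = a"
        using p unfolding INFM_nat_le by blast
      have o: "on (map p' [0..<Suc n])"
        using False n(1) by (meson le_SucI)
      then have "butlast (map p' [0..<Suc n]) = map p [0..<n]"
        by (auto simp: on_def)
      then have "\<rho> (map p' [0..<Suc n]) = 2"
        using o n(2) by (simp add: \<rho>_def del: upt_Suc)
      then show ?thesis
        using n(1) by (intro exI[of _ "Suc n"]) (auto simp: inf_branch_aut_def simp del: upt_Suc)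
    qed
  qed
  ultimately show "t \<in> bta_lang (inf_branch_aut a)"
    unfolding bta_lang_def by blast
qed

lemma wf_inf_branch_aut: "wf_bta (inf_branch_aut a)"
  by (auto simp: wf_bta_def inf_branch_aut_def)

text \<open>A one-state automaton accepts every tree, so \<open>UNIV\<close> is itself a
  generator.\<close>

lemma topspace_buchi_topology: "topspace buchi_topology = (UNIV :: 'a inftree set)"
proof -
  let ?A = "\<lparr>states = {0}, init = 0, final = {0}, trans = {(0, x, 0, 0) | x. True}\<rparr> :: 'a buchi_tree_aut"
  have "is_run ?A t (\<lambda>_. 0)" "accepting_run ?A (\<lambda>_. 0)" for t
    by (auto simp: is_run_def accepting_run_def)
  then have "bta_lang ?A = UNIV"
    unfolding bta_lang_def by blast
  moreover have "wf_bta ?A"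
    by (auto simp: wf_bta_def)
  ultimately have "UNIV \<in> (buchi_recognizable :: 'a inftree set set)"
    unfolding buchi_recognizable_def by blast
  then show ?thesis
    unfolding buchi_topology_def topology_generated_by_topspace by blast
qed

section \<open>Diagonalisation\<close>

text \<open>The hypothesis makes \<open>G\<close> admissible for well-founded recursion on the depth
  of the node, so the labels can be fixed level by level.\<close>

lemma level_recursion:
  fixes G :: "'a inftree \<Rightarrow> 'a inftree"
  assumes "\<And>t t' u. (\<And>v. length v < length u \<Longrightarrow> t v = t' v) \<Longrightarrow> G t u = G t' u"
  shows "\<exists>t. G t = t"
proof -
  let ?R = "inv_image {(m :: nat, n). m < n} length"
  have "adm_wf ?R G"
    unfolding adm_wf_def by (intro allI impI, rule assms) simp
  then have "wfrec ?R G = G (wfrec ?R G)"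
    by (intro wfrec_fixpoint wf_inv_image wf_less)
  then show ?thesis
    by (intro exI[of _ "wfrec ?R G"]) (rule sym)
qed

section \<open>Coding finite sequences of naturals as nodes\<close>

text \<open>Unary blocks, each closed by \<open>L\<close>: this embeds the infinitely branching tree
  of finite sequences into the binary tree and respects prefixes.\<close>

definition enc :: "nat list \<Rightarrow> dir list" where
  "enc s = concat (map (\<lambda>k. replicate k R @ [L]) s)"

lemma enc_simps [simp]:
  "enc [] = []" "enc (k # s) = replicate k R @ L # enc s" "enc (s @ s') = enc s @ enc s'"
  by (simp_all add: enc_def)

lemma length_le_enc: "length s \<le> length (enc s)"
  by (induction s) auto

lemma replicate_R_L_eq:
  "replicate k R @ L # x = replicate l R @ L # y \<longleftrightarrow> k = l \<and> x = y"
proof (induction k arbitrary: l)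
  case 0
  then show ?case by (cases l) auto
next
  case (Suc k)
  then show ?case by (cases l) auto
qed

text \<open>The first \<open>L\<close> ends a block, so codes are read back uniquely. The tails
  \<open>x\<close> and \<open>y\<close> express that both codes lie on a common path.\<close>

lemma enc_prefix_take:
  assumes "enc s @ x = enc s' @ y" "length s \<le> length s'"
  shows "s = take (length s) s'"
  using assms
proof (induction s arbitrary: s')
  case (Cons k s)
  then obtain l r where "s' = l # r"
    by (cases s') auto
  with Cons show ?case
    by (auto simp: replicate_R_L_eq)
qed simp

lemma branch_through_enc:
  fixes f :: "nat \<Rightarrow> nat"
  obtains p where "\<And>n. map p [0..<length (enc (map f [0..<n]))] = enc (map f [0..<n])"
proof -
  define e where "e n = enc (map f [0..<n])" for n
  have len: "n \<le> length (e n)" for n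
    using length_le_enc[of "map f [0..<n]"] by (simp add: e_def)
  have ext: "\<exists>x. e n = e m @ x" if "m \<le> n" for m n
    using that by (induction rule: dec_induct) (auto simp: e_def)
  have nth: "e m ! i = e n ! i" if "i < length (e m)" "i < length (e n)" for i m n
    using ext[of m n] ext[of n m] that by (cases "m \<le> n") (auto simp: nth_append)
  \<comment> \<open>The code of \<open>Suc i\<close> numbers has at least \<open>Suc i\<close>
    letters, so it determines direction \<open>i\<close> of the branch.\<close>
  have "map (\<lambda>i. e (Suc i) ! i) [0..<length (e n)] = e n" for n
  proof (rule nth_equalityI)
    fix i
    assume "i < length (map (\<lambda>i. e (Suc i) ! i) [0..<length (e n)])"
    moreover have "i < length (e (Suc i))"
      using len[of "Suc i"] by simp
    ultimately show "map (\<lambda>i. e (Suc i) ! i) [0..<length (e n)] ! i = e n ! i"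
      using nth[of i "Suc i" n] by simp
  qed simp
  then show thesis
    using that unfolding e_def by blast
qed

text \<open>A converse to \<open>branch_through_enc\<close>: sequences coded on one branch form a
  chain under prefix. An infinite chain has unbounded lengths, hence a limit
  \<open>f\<close>.\<close>

lemma witness_from_branch:
  fixes p :: "nat \<Rightarrow> dir"
  assumes "\<exists>\<^sub>\<infinity>n. \<exists>s. map p [0..<n] = enc s \<and> P s"
  obtains f where "\<And>N. \<exists>s. P s \<and> N \<le> length s \<and> take N s = map f [0..<N]"
proof -
  define S where "S = {s. P s \<and> (\<exists>n. map p [0..<n] = enc s)}"
  have cmp: "s = take (length s) s'" if s: "s \<in> S" "s' \<in> S" "length s \<le> length s'" for s s'
  proof -
    obtain m n where mn: "map p [0..<m] = enc s" "map p [0..<n] = enc s'"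
      using s unfolding S_def by blast
    \<comment> \<open>Both initial segments of \<open>p\<close> extend to the one of length
      \<open>m + n\<close>.\<close>
    have "\<exists>x y. map p [0..<m] @ x = map p [0..<n] @ y"
    proof -
      have "map p [0..<m] @ map p [m..<m+n] = map p [0..<m+n]"
        "map p [0..<n] @ map p [n..<n+m] = map p [0..<n+m]"
        by (simp_all flip: map_append upt_add_eq_append[OF le0])
      then show ?thesis
        by (metis add.commute)
    qed
    then show ?thesis
      using enc_prefix_take s(3) mn by metis
  qed
  have "infinite {n. \<exists>s. map p [0..<n] = enc s \<and> P s}"
    using assms by (simp add: INFM_iff_infinite)
  moreover have "{n. \<exists>s. map p [0..<n] = enc s \<and> P s} \<subseteq> (\<lambda>s. length (enc s)) ` S"
  proof
    fix n
    assume "n \<in> {n. \<exists>s. map p [0..<n] = enc s \<and> P s}"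
    then obtain s where s: "map p [0..<n] = enc s" "P s"
      by blast
    moreover have "n = length (enc s)"
      using arg_cong[OF s(1), of length] by simp
    ultimately show "n \<in> (\<lambda>s. length (enc s)) ` S"
      unfolding S_def by blast
  qed
  ultimately have "infinite S"
    using finite_subset by blast
  moreover have "inj_on length S"
  proof (rule inj_onI)
    fix s s' :: "nat list"
    assume "s \<in> S" "s' \<in> S" "length s = length s'"
    then show "s = s'"
      using cmp[of s s'] by simp
  qed
  ultimately have "infinite (length ` S)"
    using finite_imageD by blast
  then have "\<exists>s\<in>S. N \<le> length s" for N
    unfolding infinite_nat_iff_unbounded_le by blast
  then obtain g where g: "\<And>N. g N \<in> S" "\<And>N. N \<le> length (g N)"
    by metis
  have nth: "s ! i = s' ! i" if "s \<in> S" "s' \<in> S" "i < length s" "i < length s'" for s s' i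
    using cmp[of s s'] cmp[of s' s] that by (metis nat_le_linear nth_take)
  define f where "f i = g (Suc i) ! i" for i
  have "take N (g N) = map f [0..<N]" for N
  proof (rule nth_equalityI)
    fix i
    assume i: "i < length (take N (g N))"
    have "g N ! i = g (Suc i) ! i"
      using i g(2)[of "Suc i"] by (intro nth g(1)) auto
    then show "take N (g N) ! i = map f [0..<N] ! i"
      using i by (simp add: f_def)
  qed (use g(2) in simp)
  then show thesis
    using that g unfolding S_def by blast
qed

section \<open>The diagonal tree\<close>

lemma not_analytic_Compl_inf_branch:
  assumes "a \<noteq> b"
  shows "\<not> analytic (- inf_branch a)"
proof
  assume "analytic (- inf_branch a)"
  then obtain C where C: "closed_rel C" and W: "- inf_branch a = {t. \<exists>f :: nat \<Rightarrow> nat. C t f}"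
    unfolding analytic_def by blast
  \<comment> \<open>\<open>Q t s\<close> says that \<open>t\<close> and \<open>s\<close> agree with
    a point of \<open>C\<close> up to level \<open>length s\<close>. Since \<open>t'\<close> may
    differ from \<open>t\<close> further down, this inspects only finitely many levels of
    \<open>t\<close>.\<close>
  define Q where "Q t s \<longleftrightarrow> (\<exists>t' f. C t' f \<and> (\<forall>u. length u < length s \<longrightarrow> t' u = t u) \<and>
    (\<forall>i < length s. f i = s ! i))" for t s
  have Q_local: "Q t s = Q t' s" if "\<And>v. length v < length s \<Longrightarrow> t v = t' v" for t t' s
    using that unfolding Q_def by auto
  have Q_take: "Q t (take N s)" if Qs: "Q t s" for t s N
  proof -
    obtain t' f where "C t' f" "\<forall>u. length u < length s \<longrightarrow> t' u = t u" "\<forall>i < length s. f i = s ! i"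
      using Qs unfolding Q_def by blast
    then show ?thesis
      unfolding Q_def by (intro exI[of _ t'] exI[of _ f]) simp
  qed
  \<comment> \<open>Here closedness enters: a neighbourhood disjoint from \<open>C\<close> is
    decided below some level \<open>N\<close>, contradicting the approximation of length
    \<open>N\<close>.\<close>
  have C_if_Q: "C t f" if Qf: "\<And>N. Q t (map f [0..<N])" for t f
  proof (rule ccontr)
    assume "\<not> C t f"
    then obtain U I where UI: "finite U" "finite I"
      "\<And>t' f'. (\<And>u. u \<in> U \<Longrightarrow> t' u = t u) \<Longrightarrow> (\<And>i. i \<in> I \<Longrightarrow> f' i = f i) \<Longrightarrow> \<not> C t' f'"
      using C by (elim closed_relE) auto
    obtain N where N: "\<forall>n \<in> length ` U \<union> I. n < N"
      using UI(1,2) finite_nat_set_iff_bounded[of "length ` U \<union> I"] by auto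
    obtain t' f' where "C t' f'" "\<forall>u. length u < N \<longrightarrow> t' u = t u" "\<forall>i < N. f' i = f i"
      using Qf[of N] unfolding Q_def by auto
    then show False
      using UI(3)[of t' f'] N by auto
  qed
  \<comment> \<open>A fixed point of \<open>G\<close> carries \<open>a\<close> exactly at the codes
    of its own approximations.\<close>
  define G where "G t u = (if \<exists>s. u = enc s \<and> Q t s then a else b)" for t u
  have "\<exists>t. G t = t"
  proof (rule level_recursion)
    fix t t' :: "'a inftree" and u :: "dir list"
    assume eq: "\<And>v. length v < length u \<Longrightarrow> t v = t' v"
    \<comment> \<open>\<open>Q t s\<close> looks only at levels below \<open>length s\<close>, which
      is at most the depth of the node \<open>enc s\<close>, so the recursion is well
      founded.\<close>
    have "Q t s = Q t' s" if "u = enc s" for s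
      using that length_le_enc[of s] by (intro Q_local eq) simp
    then show "G t u = G t' u"
      unfolding G_def by (smt (verit))
  qed
  then obtain t where "G t = t" ..
  have "G t u = a \<longleftrightarrow> (\<exists>s. u = enc s \<and> Q t s)" for u
    using assms by (simp add: G_def)
  then have t: "t u = a \<longleftrightarrow> (\<exists>s. u = enc s \<and> Q t s)" for u
    unfolding \<open>G t = t\<close> .
  show False
  proof (cases "t \<in> inf_branch a")
    case True
    then obtain p :: "nat \<Rightarrow> dir" where "\<exists>\<^sub>\<infinity>n. t (map p [0..<n]) = a"
      unfolding inf_branch_def by blast
    then have "\<exists>\<^sub>\<infinity>n. \<exists>s. map p [0..<n] = enc s \<and> Q t s"
      by (simp add: t)
    then obtain f where "\<And>N. \<exists>s. Q t s \<and> N \<le> length s \<and> take N s = map f [0..<N]"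
      using witness_from_branch[of p "Q t"] by blast
    \<comment> \<open>The branch yields approximations of unbounded length only;
      \<open>Q_take\<close> passes to every initial segment of \<open>f\<close>.\<close>
    then have "C t f"
      by (intro C_if_Q) (metis Q_take)
    then show False
      using True W by blast
  next
    case False
    then obtain f where f: "C t f"
      using W by blast
    \<comment> \<open>\<open>t\<close> and \<open>f\<close> themselves serve as the approximating
      point, so every code on the branch of \<open>f\<close> is labelled \<open>a\<close>.\<close>
    then have Q: "Q t (map f [0..<n])" for n
      unfolding Q_def by auto
    obtain p where p: "\<And>n. map p [0..<length (enc (map f [0..<n]))] = enc (map f [0..<n])"
      using branch_through_enc[of f] by blast
    have "\<exists>\<^sub>\<infinity>n. t (map p [0..<n]) = a"
      unfolding INFM_nat_le
    proof
      fix m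
      show "\<exists>n\<ge>m. t (map p [0..<n]) = a"
      proof (intro exI conjI)
        show "m \<le> length (enc (map f [0..<m]))"
          using length_le_enc[of "map f [0..<m]"] by simp
        show "t (map p [0..<length (enc (map f [0..<m]))]) = a"
          unfolding p t using Q by blast
      qed
    qed
    then show False
      using False unfolding inf_branch_def by blast
  qed
qed

section \<open>Non-metrizability from a closed set that is not a G-delta\<close>

theorem theorem4p4:
  assumes "CARD('a::finite) \<ge> 2"
  shows "\<not> metrizable_space (buchi_topology :: 'a inftree topology)"
proof
  let ?X = "buchi_topology :: 'a inftree topology"
  assume metr: "metrizable_space ?X"
  obtain a b :: 'a where ab: "a \<noteq> b"
  proof -
    have "\<not> is_singleton (UNIV :: 'a set)"
      using assms by (auto simp: is_singleton_altdef)
    then show thesis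
      using that by (metis (full_types) is_singletonI' UNIV_not_empty)
  qed
  have "inf_branch a \<in> buchi_recognizable"
    unfolding buchi_recognizable_def using wf_inf_branch_aut[of a]
    by (auto simp flip: bta_lang_inf_branch_aut)
  then have "openin ?X (inf_branch a)"
    unfolding buchi_topology_def by (rule topology_generated_by_Basis)
  then have "closedin ?X (- inf_branch a)"
    by (simp add: closedin_def topspace_buchi_topology Compl_eq_Diff_UNIV double_diff)
  then have "gdelta_in ?X (- inf_branch a)"
    using metr closed_imp_gdelta_in by blast
  then obtain F where F: "countable F" "F \<subseteq> Collect (openin ?X)" "\<Inter>F = - inf_branch a"
    unfolding gdelta_in_alt intersection_of_def by blast
  have "analytic (\<Inter>F)"
    using F(1,2) by (intro analytic_Inter analytic_openin_buchi) blast+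
  then have "analytic (- inf_branch a)"
    unfolding F(3) .
  then show False
    using not_analytic_Compl_inf_branch[OF ab] by contradiction
qed

end
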